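(* Let $A_1$ and $B_1$ be real symmetric matrices of order $n$. Let $e_1,\dots,e_p$ be zero-one vectors of length $n$ whose supports (positions of ones) are pairwise disjoint, let $J_{i,j}=e_ie_j^\top$ for $1\le i,j\le p$, and let $\mathbf A=(A_1,J_{1,1},J_{1,2},\dots,J_{p,p})$ and $\mathbf B=(B_1,J_{1,1},J_{1,2},\dots,J_{p,p})$ (tuples of length $k=1+p^2$). Then $W_{\mathbf A}(\mathbf s)$ and $W_{\mathbf B}(\mathbf s)$ have identical characteristic polynomials (as polynomials in $\mathbf s$ and $t$) if and only if there is an orthogonal matrix $Q$, independent of $\mathbf s$, such that $Q^\top A_1Q=B_1$ and $Q^\top e_i=e_i$ for $i=1,\dots,p$ (so that $Q^\top W_{\mathbf A}(\mathbf s)Q=W_{\mathbf B}(\mathbf s)$). Moreover, such $Q$ satisfies $Q^\top\widetilde W_{A_1}=\widetilde W_{B_1}$, where for a matrix $A$, $$\widetilde W_A=[e_1,Ae_1,\dots,A^{n-1}e_1,\ e_2,Ae_2,\dots,A^{n-1}e_2,\ \dots,\ e_p,Ae_p,\dots,A^{n-1}e_p].$$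
   Context: For a tuple $\mathbf A=(A_1,\dots,A_k)$ of $n\times n$ matrices and complex variables $\mathbf s=(s_1,\dots,s_k)$, $W_{\mathbf A}(\mathbf s)=\sum_{i=1}^ks_iA_i$, with characteristic polynomial $\phi_{\mathbf A}(\mathbf s;t)=\det(tI-W_{\mathbf A}(\mathbf s))$. *)

theory Defs
  imports
    Complex_Main
    "HOL-Library.Disjoint_Sets"
    "Jordan_Normal_Form.Matrix"
    "Jordan_Normal_Form.Char_Poly"
begin

definition symmetric_matrix :: "nat \<Rightarrow> real mat \<Rightarrow> bool" where
  "symmetric_matrix n A \<longleftrightarrow> A \<in> carrier_mat n n \<and> transpose_mat A = A"

(* The library constant orthogonal_mat only asks for pairwise orthogonal
   nonzero columns; here the columns are orthonormal. *)
definition orthogonal_matrix :: "nat \<Rightarrow> real mat \<Rightarrow> bool" where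
  "orthogonal_matrix n Q \<longleftrightarrow> Q \<in> carrier_mat n n \<and> transpose_mat Q * Q = 1\<^sub>m n"

definition zero_one_vec :: "nat \<Rightarrow> real vec \<Rightarrow> bool" where
  "zero_one_vec n v \<longleftrightarrow> v \<in> carrier_vec n \<and> (\<forall>r<n. v $ r = 0 \<or> v $ r = 1)"

definition vec_support :: "real vec \<Rightarrow> nat set" where
  "vec_support v = {r. r < dim_vec v \<and> v $ r = 1}"

definition outer :: "real vec \<Rightarrow> real vec \<Rightarrow> real mat" where
  "outer u v = mat (dim_vec u) (dim_vec v) (\<lambda>(r, c). u $ r * v $ c)"

(* The tuple (A, J_{1,1}, J_{1,2}, ..., J_{p,p}) with J_{i,j} = e_i e_j^T in
   lexicographic order of (i,j); the vectors are e 0, ..., e (p - 1). *)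
definition tuple_of :: "nat \<Rightarrow> (nat \<Rightarrow> real vec) \<Rightarrow> real mat \<Rightarrow> real mat list" where
  "tuple_of p e A = A # [outer (e i) (e j). i \<leftarrow> [0..<p], j \<leftarrow> [0..<p]]"

(* W(s) = sum of s_i A_i, formed entrywise, at a point s of complex k-space,
   where k is the length of the tuple. *)
definition W :: "nat \<Rightarrow> real mat list \<Rightarrow> complex vec \<Rightarrow> complex mat" where
  "W n As s = mat n n (\<lambda>rc. \<Sum>i<length As. s $ i * complex_of_real ((As ! i) $$ rc))"

(* det (t I - W(s)), a polynomial in t. Two such families are identical as
   polynomials in s and t iff they agree at every complex s, since the complex
   field is infinite. *)
definition phi :: "nat \<Rightarrow> real mat list \<Rightarrow> complex vec \<Rightarrow> complex poly" where
  "phi n As s = char_poly (W n As s)"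

(* Columns A^j e_i for j < n, grouped by i; an n x (p n) matrix. *)
definition W_tilde :: "nat \<Rightarrow> nat \<Rightarrow> (nat \<Rightarrow> real vec) \<Rightarrow> real mat \<Rightarrow> real mat" where
  "W_tilde n p e A = mat_of_cols n [(A ^\<^sub>m j) *\<^sub>v e i. i \<leftarrow> [0..<p], j \<leftarrow> [0..<n]]"

definition conjugates_fixing ::
  "nat \<Rightarrow> nat \<Rightarrow> (nat \<Rightarrow> real vec) \<Rightarrow> real mat \<Rightarrow> real mat \<Rightarrow> real mat \<Rightarrow> bool" where
  "conjugates_fixing n p e A B Q \<longleftrightarrow>
     orthogonal_matrix n Q \<and> transpose_mat Q * A * Q = B \<and>
     (\<forall>i<p. transpose_mat Q *\<^sub>v e i = e i)"

end

theory Submission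
  imports Defs
begin

text \<open>
  Testing the equality of characteristic polynomials at \<open>A\<close> and at \<open>A + e\<^sub>i e\<^sub>j\<^sup>T\<close> suffices.
  The first gives a common spectrum, so \<open>U\<^sup>T A U = D = V\<^sup>T B V\<close> with one diagonal matrix \<open>D\<close>.
  By the matrix determinant lemma the second says that the rational functions
  \<open>e\<^sub>i\<^sup>T (t - A)\<^sup>-\<^sup>1 e\<^sub>j\<close> and \<open>e\<^sub>i\<^sup>T (t - B)\<^sup>-\<^sup>1 e\<^sub>j\<close> agree; comparing their residues shows that,
  within each eigenspace of \<open>D\<close>, the components of the \<open>U\<^sup>T e\<^sub>i\<close> and of the \<open>V\<^sup>T e\<^sub>i\<close> have the same Gram
  matrix. A product \<open>R\<close> of reflections along eigenvectors of \<open>D\<close> then commutes with \<open>D\<close> and maps every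
  \<open>U\<^sup>T e\<^sub>i\<close> to \<open>V\<^sup>T e\<^sub>i\<close>, and \<open>Q = U R\<^sup>T V\<^sup>T\<close> is the required matrix.
\<close>

section \<open>Matrices determined by their action on vectors, and rank-one matrices\<close>

lemma eq_mat_on_vecI:
  fixes A B :: "'a :: comm_semiring_1 mat"
  assumes A: "A \<in> carrier_mat n m" and B: "B \<in> carrier_mat n m"
    and eq: "\<And>x. x \<in> carrier_vec m \<Longrightarrow> A *\<^sub>v x = B *\<^sub>v x"
  shows "A = B"
proof (rule eq_matI)
  fix i j assume ij: "i < dim_row B" "j < dim_col B"
  have entry: "(M *\<^sub>v unit_vec m j) $ i = M $$ (i, j)" if "M \<in> carrier_mat n m" for M :: "'a mat"
    using that ij B by auto
  show "A $$ (i, j) = B $$ (i, j)"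
    using entry[OF A] entry[OF B] eq[of "unit_vec m j"] by simp
qed (use A B in auto)

lemma transpose_mult_vec_scalar_prod:
  fixes A :: "'a :: comm_semiring_0 mat"
  assumes "A \<in> carrier_mat n m" "x \<in> carrier_vec n" "y \<in> carrier_vec m"
  shows "(transpose_mat A *\<^sub>v x) \<bullet> y = x \<bullet> (A *\<^sub>v y)"
  using transpose_vec_mult_scalar[OF assms(1,3,2)] .

lemma outer_carrier [simp]:
  "u \<in> carrier_vec n \<Longrightarrow> v \<in> carrier_vec m \<Longrightarrow> outer u v \<in> carrier_mat n m"
  by (auto simp: outer_def)

lemma outer_mult_vec:
  assumes "u \<in> carrier_vec n" "v \<in> carrier_vec m" "x \<in> carrier_vec m"
  shows "outer u v *\<^sub>v x = (v \<bullet> x) \<cdot>\<^sub>v u"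
  using assms by (intro eq_vecI)
    (auto simp: outer_def scalar_prod_def sum_distrib_right sum_distrib_left mult_ac intro!: sum.cong)

text \<open>Both sides send \<open>x\<close> to \<open>(v . Q x) A u\<close>. With
  \<open>Q^T\<close> on the left and \<open>Q\<close> on the right this shows how conjugation acts
  on the matrices \<open>e_i e_j^T\<close>.\<close>

lemma mult_outer_mult:
  assumes A: "A \<in> carrier_mat n n" and Q: "Q \<in> carrier_mat n n"
    and u: "u \<in> carrier_vec n" and v: "v \<in> carrier_vec n"
  shows "A * outer u v * Q = outer (A *\<^sub>v u) (transpose_mat Q *\<^sub>v v)"
proof (rule eq_mat_on_vecI)
  fix x :: "real vec" assume x: "x \<in> carrier_vec n"
  have "A * outer u v * Q *\<^sub>v x = A *\<^sub>v (outer u v *\<^sub>v (Q *\<^sub>v x))"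
    using assms x by (simp add: assoc_mult_mat_vec[of _ n n _ n])
  also have "\<dots> = (v \<bullet> (Q *\<^sub>v x)) \<cdot>\<^sub>v (A *\<^sub>v u)"
    using assms x by (simp add: outer_mult_vec[of _ n _ n] mult_mat_vec[of _ n n])
  also have "\<dots> = outer (A *\<^sub>v u) (transpose_mat Q *\<^sub>v v) *\<^sub>v x"
    using assms x by (subst outer_mult_vec[of _ n _ n]) (auto simp: transpose_mult_vec_scalar_prod[of _ n n])
  finally show "A * outer u v * Q *\<^sub>v x = outer (A *\<^sub>v u) (transpose_mat Q *\<^sub>v v) *\<^sub>v x" .
qed (use assms in auto)

section \<open>Orthogonal matrices\<close>

lemma scalar_prod_self_eq_0:
  fixes w :: "real vec"
  assumes "w \<in> carrier_vec n"
  shows "w \<bullet> w = 0 \<longleftrightarrow> w = 0\<^sub>v n"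
  using conjugate_square_eq_0_vec[OF assms]
  by (simp add: scalar_prod_def conjugate_vec_def)

lemma orthogonal_matrixD:
  assumes "orthogonal_matrix n Q"
  shows "Q \<in> carrier_mat n n" "transpose_mat Q * Q = 1\<^sub>m n" "Q * transpose_mat Q = 1\<^sub>m n"
proof -
  show Q: "Q \<in> carrier_mat n n" and QQ: "transpose_mat Q * Q = 1\<^sub>m n"
    using assms unfolding orthogonal_matrix_def by blast+
  show "Q * transpose_mat Q = 1\<^sub>m n"
    by (rule mat_mult_left_right_inverse[OF _ Q QQ]) (simp add: Q)
qed

lemma orthogonal_matrix_transpose:
  "orthogonal_matrix n Q \<Longrightarrow> orthogonal_matrix n (transpose_mat Q)"
  unfolding orthogonal_matrix_def[of n "transpose_mat Q"] transpose_transpose transpose_carrier_mat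
  by (intro conjI orthogonal_matrixD)

lemma orthogonal_matrix_one: "orthogonal_matrix n (1\<^sub>m n)"
  by (simp add: orthogonal_matrix_def)

lemma orthogonal_matrix_mult:
  assumes P: "orthogonal_matrix n P" and Q: "orthogonal_matrix n Q"
  shows "orthogonal_matrix n (P * Q)"
proof -
  note P = orthogonal_matrixD[OF P] and Q = orthogonal_matrixD[OF Q]
  have "transpose_mat (P * Q) * (P * Q) = transpose_mat Q * (transpose_mat P * P) * Q"
    using P(1) Q(1) by (simp add: transpose_mult[of _ n n] assoc_mult_mat[of _ n n _ n _ n])
  then show ?thesis using P Q by (simp add: orthogonal_matrix_def)
qed

lemma orthogonal_matrix_mult_vec:
  assumes "orthogonal_matrix n Q" "x \<in> carrier_vec n"
  shows "transpose_mat Q *\<^sub>v (Q *\<^sub>v x) = x" "Q *\<^sub>v (transpose_mat Q *\<^sub>v x) = x"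
proof -
  note Q = orthogonal_matrixD[OF assms(1)]
  have Qt: "transpose_mat Q \<in> carrier_mat n n" using Q(1) by simp
  show "transpose_mat Q *\<^sub>v (Q *\<^sub>v x) = x"
    using assoc_mult_mat_vec[OF Qt Q(1) assms(2)] unfolding Q(2) one_mult_mat_vec[OF assms(2)] by (rule sym)
  show "Q *\<^sub>v (transpose_mat Q *\<^sub>v x) = x"
    using assoc_mult_mat_vec[OF Q(1) Qt assms(2)] unfolding Q(3) one_mult_mat_vec[OF assms(2)] by (rule sym)
qed

lemma orthogonal_matrix_scalar_prod:
  assumes Q: "orthogonal_matrix n Q" and x: "x \<in> carrier_vec n" and y: "y \<in> carrier_vec n"
  shows "(Q *\<^sub>v x) \<bullet> (Q *\<^sub>v y) = x \<bullet> y"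
proof -
  note Qc = orthogonal_matrixD(1)[OF Q]
  have "(Q *\<^sub>v x) \<bullet> (Q *\<^sub>v y) = x \<bullet> (transpose_mat Q *\<^sub>v (Q *\<^sub>v y))"
    using transpose_mult_vec_scalar_prod[of "transpose_mat Q" n n x "Q *\<^sub>v y"] Qc x y by simp
  then show ?thesis unfolding orthogonal_matrix_mult_vec(1)[OF Q y] .
qed

text \<open>The reflection in the hyperplane orthogonal to \<open>w\<close>. For
  \<open>w = 0\<close> the formula gives the identity, so later lemmas need not exclude that
  case.\<close>

definition householder :: "nat \<Rightarrow> real vec \<Rightarrow> real mat" where
  "householder n w = 1\<^sub>m n - (2 / (w \<bullet> w)) \<cdot>\<^sub>m outer w w"

lemma householder_carrier [simp]: "w \<in> carrier_vec n \<Longrightarrow> householder n w \<in> carrier_mat n n"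
  unfolding householder_def by (intro minus_carrier_mat smult_carrier_mat outer_carrier)

lemma householder_mult_vec:
  assumes w: "w \<in> carrier_vec n" and x: "x \<in> carrier_vec n"
  shows "householder n w *\<^sub>v x = x - (2 * (w \<bullet> x) / (w \<bullet> w)) \<cdot>\<^sub>v w"
proof -
  have "((2 / (w \<bullet> w)) \<cdot>\<^sub>m outer w w) *\<^sub>v x = (2 / (w \<bullet> w)) \<cdot>\<^sub>v (outer w w *\<^sub>v x)"
    using assms by (intro eq_vecI) (auto simp: outer_def)
  then show ?thesis
    using assms by (simp add: householder_def minus_mult_distrib_mat_vec[of _ n n] outer_mult_vec[of _ n _ n]
        smult_smult_assoc)
qed

lemma transpose_householder:
  "w \<in> carrier_vec n \<Longrightarrow> transpose_mat (householder n w) = householder n w"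
  by (intro eq_matI) (auto simp: householder_def outer_def)

lemma householder_scalar_prod_self:
  assumes w: "w \<in> carrier_vec n" and x: "x \<in> carrier_vec n"
  shows "w \<bullet> (householder n w *\<^sub>v x) = - (w \<bullet> x)"
proof (cases "w = 0\<^sub>v n")
  case False
  then have "w \<bullet> w \<noteq> 0"
    using w scalar_prod_self_eq_0 by blast
  then show ?thesis
    using assms by (simp add: householder_mult_vec scalar_prod_minus_distrib[of _ n])
qed (use x in \<open>auto simp: householder_mult_vec\<close>)

text \<open>A reflection is symmetric and an involution: it negates the component along
  \<open>w\<close>, so a second application restores what the first subtracted.\<close>

lemma orthogonal_matrix_householder:
  assumes w: "w \<in> carrier_vec n"
  shows "orthogonal_matrix n (householder n w)"
proof -
  have "householder n w * householder n w = 1\<^sub>m n"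
  proof (rule eq_mat_on_vecI)
    fix x :: "real vec" assume x: "x \<in> carrier_vec n"
    have "householder n w *\<^sub>v (householder n w *\<^sub>v x)
        = householder n w *\<^sub>v x + (2 * (w \<bullet> x) / (w \<bullet> w)) \<cdot>\<^sub>v w"
      using w x mult_mat_vec_carrier[OF householder_carrier[OF w] x]
      by (subst householder_mult_vec[OF w]) (auto simp: householder_scalar_prod_self)
    also have "\<dots> = x"
      using w x by (auto simp: householder_mult_vec)
    finally show "householder n w * householder n w *\<^sub>v x = 1\<^sub>m n *\<^sub>v x"
      using w x by (simp add: assoc_mult_mat_vec[of _ n n _ n])
  qed (use w in \<open>auto intro!: mult_carrier_mat[of _ n n]\<close>)
  then show ?thesis using w by (simp add: orthogonal_matrix_def transpose_householder)
qed

lemma householder_fixes: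
  "w \<in> carrier_vec n \<Longrightarrow> x \<in> carrier_vec n \<Longrightarrow> w \<bullet> x = 0 \<Longrightarrow> householder n w *\<^sub>v x = x"
  by (auto simp: householder_mult_vec)

text \<open>Equal norms give \<open>(x - y) . (x - y) = 2 ((x - y) . x)\<close>, so the reflection
  subtracts exactly \<open>x - y\<close> from \<open>x\<close>. If \<open>x = y\<close>, the
  reflection is the identity.\<close>

lemma householder_maps:
  assumes x: "x \<in> carrier_vec n" and y: "y \<in> carrier_vec n" and xy: "x \<bullet> x = y \<bullet> y"
  shows "householder n (x - y) *\<^sub>v x = y"
proof (cases "x - y = 0\<^sub>v n")
  case True
  then have "(x - y) $ i = 0" if "i < n" for i
    using that by simp
  then have "x = y"
    using x y by (intro eq_vecI) auto
  then show ?thesis using x by (auto simp: householder_mult_vec)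
next
  case False
  then have nz: "(x - y) \<bullet> (x - y) \<noteq> 0"
    using x y scalar_prod_self_eq_0[of "x - y" n] by auto
  have "(x - y) \<bullet> (x - y) = 2 * ((x - y) \<bullet> x)"
    using x y xy comm_scalar_prod[OF x y]
    by (simp add: scalar_prod_minus_distrib[of _ n] minus_scalar_prod_distrib[of _ n])
  then have "2 * ((x - y) \<bullet> x) / ((x - y) \<bullet> (x - y)) = 1" using nz by simp
  moreover have "x - 1 \<cdot>\<^sub>v (x - y) = y" using x y by auto
  moreover have "x - y \<in> carrier_vec n" using x y by simp
  ultimately show ?thesis using householder_mult_vec[OF _ x] by metis
qed

text \<open>Symmetry gives \<open>w . A x = A w . x = c (w . x)\<close>, so both products subtract
  the same multiple of \<open>w\<close> from \<open>A x\<close>.\<close>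

lemma householder_commutes:
  assumes A: "symmetric_matrix n A" and w: "w \<in> carrier_vec n" and Aw: "A *\<^sub>v w = c \<cdot>\<^sub>v w"
  shows "A * householder n w = householder n w * A"
proof (rule eq_mat_on_vecI)
  fix x :: "real vec" assume x: "x \<in> carrier_vec n"
  have Ac: "A \<in> carrier_mat n n" and At: "transpose_mat A = A"
    using A by (auto simp: symmetric_matrix_def)
  have Ax: "A *\<^sub>v x \<in> carrier_vec n" using Ac x by simp
  have eq: "w \<bullet> (A *\<^sub>v x) = c * (w \<bullet> x)"
    using transpose_mult_vec_scalar_prod[OF Ac w x] At Aw w x by simp
  have "A *\<^sub>v (householder n w *\<^sub>v x) = A *\<^sub>v x - (2 * (w \<bullet> x) / (w \<bullet> w)) \<cdot>\<^sub>v (c \<cdot>\<^sub>v w)"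
    using Ac w x by (simp add: householder_mult_vec mult_minus_distrib_mat_vec[of _ n n] mult_mat_vec[of _ n n] Aw)
  also have "\<dots> = householder n w *\<^sub>v (A *\<^sub>v x)"
    using w Ax by (simp add: householder_mult_vec eq smult_smult_assoc mult_ac)
  finally show "A * householder n w *\<^sub>v x = householder n w * A *\<^sub>v x"
    using Ac w x by (simp add: assoc_mult_mat_vec[of _ n n _ n])
qed (use A w in \<open>auto simp: symmetric_matrix_def intro!: mult_carrier_mat[of _ n n]\<close>)

section \<open>Orthogonal diagonalization of symmetric matrices\<close>

interpretation of_real_poly_hom: map_poly_inj_idom_hom complex_of_real ..

text \<open>For a complex eigenvector \<open>v\<close>, moving the real symmetric matrix across
  \<open>v . conjugate v\<close> produces the factor \<open>a\<close> on one side and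
  \<open>cnj a\<close> on the other, and this product is nonzero.\<close>

lemma symmetric_eigenvalue_real:
  assumes A: "symmetric_matrix n A" and ev: "eigenvalue (map_mat complex_of_real A) a"
  shows "a \<in> \<real>"
proof -
  define C where "C = map_mat complex_of_real A"
  have C: "C \<in> carrier_mat n n" and Ct: "transpose_mat C = C"
    using A by (auto simp: C_def symmetric_matrix_def map_mat_transpose)
  obtain v where v: "v \<in> carrier_vec n" "v \<noteq> 0\<^sub>v n" and Cv: "C *\<^sub>v v = a \<cdot>\<^sub>v v"
    using ev C unfolding eigenvalue_def eigenvector_def C_def by auto
  have cv: "conjugate v \<in> carrier_vec n" using v by simp
  have "C *\<^sub>v conjugate v = conjugate (C *\<^sub>v v)"
    using v A by (intro eq_vecI) (auto simp: C_def symmetric_matrix_def scalar_prod_def)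
  also have "\<dots> = cnj a \<cdot>\<^sub>v conjugate v"
    by (simp add: Cv conjugate_smult_vec)
  finally have "a * (v \<bullet> conjugate v) = cnj a * (v \<bullet> conjugate v)"
    using transpose_mult_vec_scalar_prod[OF C v(1) cv] v(1) cv by (simp add: Ct Cv)
  moreover have "v \<bullet> conjugate v \<noteq> 0"
    using conjugate_square_eq_0_vec[OF v(1)] v(2) by simp
  ultimately show ?thesis by (simp add: Reals_cnj_iff)
qed

text \<open>The polynomial splits over the complex numbers and all its roots are real, so the
  factorization is the image of a real one; injectivity of the embedding pulls it back.\<close>

lemma symmetric_char_poly_factorized:
  assumes A: "symmetric_matrix n A"
  obtains es where "char_poly A = (\<Prod>a\<leftarrow>es. [:- a, 1:])"
proof -
  have Ac: "A \<in> carrier_mat n n" using A by (simp add: symmetric_matrix_def)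
  define C where "C = map_mat complex_of_real A"
  have C: "C \<in> carrier_mat n n" using Ac by (simp add: C_def)
  obtain as where as: "char_poly C = (\<Prod>a\<leftarrow>as. [:- a, 1:])"
    using char_poly_factorized[OF C] by blast
  have real: "complex_of_real (Re a) = a" if "a \<in> set as" for a
  proof -
    have "poly (char_poly C) a = 0"
      using that by (auto simp: as poly_prod_list prod_list_zero_iff)
    then have "a \<in> \<real>"
      using eigenvalue_root_char_poly[OF C] symmetric_eigenvalue_real[OF A] by (simp add: C_def)
    then show ?thesis by simp
  qed
  have "map_poly complex_of_real (char_poly A) = char_poly C"
    by (simp add: C_def of_real_hom.char_poly_hom[OF Ac])
  also have "\<dots> = (\<Prod>a\<leftarrow>as. map_poly complex_of_real [:- Re a, 1:])"
    unfolding as using real by (intro arg_cong[where f = prod_list] map_cong) auto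
  also have "\<dots> = map_poly complex_of_real (\<Prod>a\<leftarrow>map Re as. [:- a, 1:])"
    by (simp add: of_real_poly_hom.hom_prod_list o_def)
  finally have "char_poly A = (\<Prod>a\<leftarrow>map Re as. [:- a, 1:])"
    by (rule of_real_poly_hom.injectivity)
  then show ?thesis by (rule that)
qed

lemma orthogonal_conjugation_symmetric:
  assumes A: "symmetric_matrix n A" and Q: "orthogonal_matrix n Q"
  shows "symmetric_matrix n (transpose_mat Q * A * Q)"
proof -
  have "A \<in> carrier_mat n n" "transpose_mat A = A" "Q \<in> carrier_mat n n" "transpose_mat Q \<in> carrier_mat n n"
    using A orthogonal_matrixD(1)[OF Q] by (auto simp: symmetric_matrix_def)
  then show ?thesis
    unfolding symmetric_matrix_def
    by (simp add: transpose_mult[of _ n n _ n] assoc_mult_mat[of _ n n _ n _ n])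
qed

lemma orthogonal_conjugation_char_poly:
  fixes A :: "real mat"
  assumes A: "A \<in> carrier_mat n n" and Q: "orthogonal_matrix n Q"
  shows "char_poly (transpose_mat Q * A * Q) = char_poly A"
proof (rule char_poly_similar)
  note QD = orthogonal_matrixD[OF Q]
  have Qt: "transpose_mat Q \<in> carrier_mat n n" using QD(1) by simp
  have "{transpose_mat Q * A * Q, A, transpose_mat Q, Q} \<subseteq> carrier_mat n n"
    using mult_carrier_mat[OF mult_carrier_mat[OF Qt A] QD(1)] A Qt QD(1) by blast
  then show "similar_mat (transpose_mat Q * A * Q) A"
    by (rule similar_matI[OF _ QD(2,3) refl])
qed

text \<open>Induction on the roots, splitting off one unit eigenvector at a time. The list
  \<open>es\<close> prescribes the order of the diagonal, so matrices with equal characteristic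
  polynomials reach literally the same diagonal matrix.\<close>

lemma orthogonal_diagonalization:
  assumes "symmetric_matrix n A" and "char_poly A = (\<Prod>a\<leftarrow>es. [:- a, 1:])"
  shows "\<exists>U. orthogonal_matrix n U \<and> transpose_mat U * A * U = mat_diag n ((!) es)"
  using assms
proof (induction es arbitrary: n A)
  case Nil
  \<comment> \<open>The empty product has degree 0, which is the size of the matrix.\<close>
  then have "A \<in> carrier_mat n n" "n = 0"
    using degree_monic_char_poly[of A n] by (auto simp: symmetric_matrix_def)
  then show ?case
    by (intro exI[of _ "1\<^sub>m 0"]) (auto simp: orthogonal_matrix_one mat_diag_def)
next
  case (Cons a as)
  have A: "A \<in> carrier_mat n n" using Cons.prems(1) by (simp add: symmetric_matrix_def)
  have "eigenvalue A a"
    using Cons.prems(2) by (simp add: eigenvalue_root_char_poly[OF A])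
  then obtain v where v: "v \<in> carrier_vec n" "v \<noteq> 0\<^sub>v n" and Av: "A *\<^sub>v v = a \<cdot>\<^sub>v v"
    using A by (auto simp: eigenvalue_def eigenvector_def)
  obtain m where n: "n = Suc m"
    using v by (cases n) auto
  define u where "u = (1 / sqrt (v \<bullet> v)) \<cdot>\<^sub>v v"
  have u: "u \<in> carrier_vec n" and Au: "A *\<^sub>v u = a \<cdot>\<^sub>v u"
    using v A by (auto simp: u_def mult_mat_vec[of _ n n] Av smult_smult_assoc mult.commute)
  have "v \<bullet> v > 0"
    using v scalar_prod_self_eq_0[of v n] by (auto simp: less_le scalar_prod_def intro: sum_nonneg)
  then have uu: "u \<bullet> u = 1"
    using v by (simp add: u_def)
  define e where "e = (unit_vec n 0 :: real vec)"
  have e: "e \<in> carrier_vec n" "e \<bullet> e = 1" by (simp_all add: e_def n)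
  \<comment> \<open>Both \<open>u\<close> and \<open>e\<close> are unit vectors, so this reflection
    swaps them and \<open>e\<close> becomes an eigenvector of the conjugate
    \<open>M\<close>.\<close>
  define H where "H = householder n (u - e)"
  have H: "orthogonal_matrix n H" and Ht: "transpose_mat H = H" and Hu: "H *\<^sub>v u = e"
    using u e uu by (simp_all add: H_def orthogonal_matrix_householder transpose_householder householder_maps)
  have Hc: "H \<in> carrier_mat n n" using orthogonal_matrixD[OF H] by simp
  have He: "H *\<^sub>v e = u"
    using orthogonal_matrix_mult_vec(1)[OF H u] by (simp add: Hu Ht)
  define M where "M = transpose_mat H * A * H"
  have M: "symmetric_matrix n M" and cpM: "char_poly M = (\<Prod>a\<leftarrow>a # as. [:- a, 1:])"
    using orthogonal_conjugation_symmetric[OF Cons.prems(1) H]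
      orthogonal_conjugation_char_poly[OF A H] Cons.prems(2) by (simp_all add: M_def)
  have Mc: "M \<in> carrier_mat n n" and Mt: "transpose_mat M = M"
    using M by (simp_all add: symmetric_matrix_def)
  have Me: "M *\<^sub>v e = a \<cdot>\<^sub>v e"
    using A Hc e u by (simp add: M_def Ht assoc_mult_mat_vec[of _ n n _ n] He Au mult_mat_vec[of _ n n] Hu)
  have col0: "M $$ (i, 0) = (if i = 0 then a else 0)" if "i < n" for i
    using arg_cong[OF Me, of "\<lambda>x. x $ i"] that Mc by (simp add: e_def n)
  \<comment> \<open>Symmetry carries the shape of the first column over to the first row, so
    \<open>M\<close> is block diagonal.\<close>
  have row0: "M $$ (0, j) = (if j = 0 then a else 0)" if "j < n" for j
  proof -
    have "transpose_mat M $$ (0, j) = M $$ (j, 0)" using that Mc n by simp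
    then show ?thesis using col0[OF that] Mt by simp
  qed
  define M' where "M' = mat m m (\<lambda>(i, j). M $$ (Suc i, Suc j))"
  define E where "E = mat 1 1 (\<lambda>_. a)"
  have M'c: "M' \<in> carrier_mat m m" and Ec: "E \<in> carrier_mat 1 1" by (simp_all add: M'_def E_def)
  have block: "M = four_block_mat E (0\<^sub>m 1 m) (0\<^sub>m m 1) M'"
    using Mc n by (intro eq_matI) (auto simp: E_def M'_def col0 row0)
  have M': "symmetric_matrix m M'"
  proof -
    have "M $$ (Suc j, Suc i) = M $$ (Suc i, Suc j)" if "i < m" "j < m" for i j
      using arg_cong[OF Mt, of "\<lambda>X. X $$ (Suc i, Suc j)"] that Mc n by simp
    then show ?thesis
      by (auto simp: symmetric_matrix_def M'_def intro!: eq_matI)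
  qed
  have cpE: "char_poly E = [:- a, 1:]"
    by (subst char_poly_upper_triangular[OF Ec]) (auto simp: E_def diag_mat_def)
  \<comment> \<open>Cancelling the linear factor of the split-off root leaves the premise of the
    induction hypothesis for \<open>M'\<close>.\<close>
  have "[:- a, 1:] * char_poly M' = [:- a, 1:] * (\<Prod>a\<leftarrow>as. [:- a, 1:])"
    using cpM char_poly_four_block_zeros_col[OF Ec, of "0\<^sub>m 1 m" m M'] M'c by (simp add: block cpE)
  then have "char_poly M' = (\<Prod>a\<leftarrow>as. [:- a, 1:])"
    by (simp only: mult_cancel_left) auto
  from Cons.IH[OF M' this] obtain U' where U': "orthogonal_matrix m U'"
    and diag: "transpose_mat U' * M' * U' = mat_diag m ((!) as)" by blast
  note U'D = orthogonal_matrixD[OF U']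
  define U where "U = four_block_mat (1\<^sub>m 1) (0\<^sub>m 1 m) (0\<^sub>m m 1) U'"
  have Uc: "U \<in> carrier_mat n n" using U'D n unfolding U_def
    by (metis four_block_carrier_mat one_carrier_mat plus_1_eq_Suc)
  have Ut: "transpose_mat U = four_block_mat (1\<^sub>m 1) (0\<^sub>m 1 m) (0\<^sub>m m 1) (transpose_mat U')"
    unfolding U_def using U'D by (subst transpose_four_block_mat[of _ 1 1 _ m _ m]) auto
  have "transpose_mat U * U = four_block_mat (1\<^sub>m 1) (0\<^sub>m 1 m) (0\<^sub>m m 1) (1\<^sub>m m)"
    unfolding Ut unfolding U_def using U'D
    by (subst mult_four_block_mat[of _ 1 1 _ m _ m _ _ 1 _ m]) auto
  then have U: "orthogonal_matrix n U"
    using Uc n by (simp add: orthogonal_matrix_def)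
  have "transpose_mat U * M * U = four_block_mat E (0\<^sub>m 1 m) (0\<^sub>m m 1) (transpose_mat U' * M' * U')"
    unfolding Ut unfolding U_def block using U'D M'c Ec
    by (subst mult_four_block_mat[of _ 1 1 _ m _ m _ _ 1 _ m]; simp?)+
  also have "\<dots> = mat_diag n ((!) (a # as))"
    unfolding diag using n by (intro eq_matI) (auto simp: mat_diag_def E_def nth_Cons')
  finally have "transpose_mat (H * U) * A * (H * U) = mat_diag n ((!) (a # as))"
    using Hc Uc A by (simp add: M_def transpose_mult[of _ n n _ n] assoc_mult_mat[of _ n n _ n _ n])
  then show ?case using orthogonal_matrix_mult[OF H U] by blast
qed

section \<open>Rank-one perturbations of diagonal matrices\<close>

lemma det_mat_diag_minus_outer:
  assumes u: "u \<in> carrier_vec n" and v: "v \<in> carrier_vec n" and f: "\<And>r. r < n \<Longrightarrow> f r \<noteq> 0"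
  shows "det (mat_diag n f - outer u v) = (\<Prod>r<n. f r) * (1 - (\<Sum>r<n. u $ r * v $ r / f r))"
proof -
  \<comment> \<open>Both sides are the determinant of the bordered matrix \<open>X = [D, u; v\<^sup>T, 1]\<close>, factorized in two ways.\<close>
  define D where "D = mat_diag n f"
  define c where "c = mat n 1 (\<lambda>(i, _). u $ i)"
  define w where "w = mat n 1 (\<lambda>(i, _). u $ i / f i)"
  define r where "r = mat 1 n (\<lambda>(_, j). v $ j)"
  define s where "s = mat 1 1 (\<lambda>_. 1 - (\<Sum>r<n. u $ r * v $ r / f r))"
  define X where "X = four_block_mat D c r (1\<^sub>m 1)"
  have carr: "D \<in> carrier_mat n n" "c \<in> carrier_mat n 1" "w \<in> carrier_mat n 1" "r \<in> carrier_mat 1 n"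
    "s \<in> carrier_mat 1 1"
    by (auto simp: D_def c_def w_def r_def s_def)
  have cr: "c * r = outer u v"
    using u v by (intro eq_matI) (auto simp: c_def r_def outer_def scalar_prod_def)
  \<comment> \<open>\<open>w\<close> is \<open>D^-1 u\<close>; the nonvanishing of \<open>f\<close>
    enters here.\<close>
  have Dw: "D * w = c"
    using f by (subst D_def, subst mat_diag_mult_left[OF carr(3)]) (auto intro!: eq_matI simp: w_def c_def)
  have rw: "r * w + s = 1\<^sub>m 1"
    using u v by (intro eq_matI)
      (auto simp: r_def w_def s_def scalar_prod_def lessThan_atLeast0 mult.commute)
  define D' where "D' = D - outer u v"
  have D': "D' \<in> carrier_mat n n"
    using u v by (simp add: D'_def minus_carrier_mat)
  have D'_plus: "D' + outer u v = D"
    using carr(1) u v by (intro eq_matI) (simp_all add: D'_def outer_def)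
  \<comment> \<open>Eliminating with the corner entry 1 leaves the Schur complement
    \<open>D - u v^T\<close>.\<close>
  have X1: "X = four_block_mat (1\<^sub>m n) c (0\<^sub>m 1 n) (1\<^sub>m 1) * four_block_mat D' (0\<^sub>m n 1) r (1\<^sub>m 1)"
    unfolding X_def
    by (subst mult_four_block_mat[OF one_carrier_mat carr(2) zero_carrier_mat one_carrier_mat
          D' zero_carrier_mat carr(4) one_carrier_mat])
      (use carr(2,4) D' in \<open>simp add: cr D'_plus\<close>)
  \<comment> \<open>Eliminating with \<open>D\<close> leaves the scalar Schur complement
    \<open>1 - v^T D^-1 u\<close>.\<close>
  have X2: "X = four_block_mat D (0\<^sub>m n 1) r (1\<^sub>m 1) * four_block_mat (1\<^sub>m n) w (0\<^sub>m 1 n) s"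
    unfolding X_def
    by (subst mult_four_block_mat[OF carr(1) zero_carrier_mat carr(4) one_carrier_mat
          one_carrier_mat carr(3) zero_carrier_mat carr(5)])
      (use carr in \<open>simp add: Dw rw\<close>)
  have "det X = det D'"
    unfolding X1
      det_mult[OF four_block_carrier_mat[OF one_carrier_mat one_carrier_mat]
        four_block_carrier_mat[OF D' one_carrier_mat]]
      det_four_block_mat_lower_left_zero[OF one_carrier_mat carr(2) refl one_carrier_mat]
      det_four_block_mat_upper_right_zero[OF D' refl carr(4) one_carrier_mat]
    by simp
  moreover have "det X = det D * det s"
    unfolding X2
      det_mult[OF four_block_carrier_mat[OF carr(1) one_carrier_mat]
        four_block_carrier_mat[OF one_carrier_mat carr(5)]]
      det_four_block_mat_lower_left_zero[OF one_carrier_mat carr(3) refl carr(5)]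
      det_four_block_mat_upper_right_zero[OF carr(1) refl carr(4) one_carrier_mat]
    by simp
  moreover have "det D = (\<Prod>r<n. f r)"
    using det_upper_triangular[OF _ carr(1)]
    by (auto simp: D_def mat_diag_def upper_triangular_def diag_mat_def prod.list_conv_set_nth lessThan_atLeast0)
  moreover have "det s = 1 - (\<Sum>r<n. u $ r * v $ r / f r)"
    by (simp add: det_single s_def)
  ultimately show ?thesis by (simp add: D'_def D_def)
qed

lemma poly_char_poly_mat_diag_plus_outer:
  assumes u: "u \<in> carrier_vec n" and v: "v \<in> carrier_vec n" and t: "\<And>r. r < n \<Longrightarrow> t \<noteq> d r"
  shows "poly (char_poly (mat_diag n d + outer u v)) t
    = (\<Prod>r<n. t - d r) * (1 - (\<Sum>r<n. u $ r * v $ r / (t - d r)))"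
proof -
  have "mat_diag n d + outer u v \<in> carrier_mat n n" using u v by simp
  moreover have "- char_matrix (mat_diag n d + outer u v) t = mat_diag n (\<lambda>r. t - d r) - outer u v"
    using u v by (intro eq_matI) (auto simp: char_matrix_def mat_diag_def outer_def)
  ultimately show ?thesis
    using t by (simp add: char_poly_matrix det_mat_diag_minus_outer[OF u v])
qed

text \<open>Multiply by \<open>t - l\<close> and let \<open>t\<close> tend to \<open>l\<close>: only
  the terms with their pole at \<open>l\<close> survive. The values \<open>d r\<close> may repeat,
  so the residue is a sum over all indices sharing that pole.\<close>

lemma partial_fractions_residue_zero:
  fixes d g :: "nat \<Rightarrow> real"
  assumes zero: "\<And>t. (\<And>r. r < n \<Longrightarrow> t \<noteq> d r) \<Longrightarrow> (\<Sum>r<n. g r / (t - d r)) = 0"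
  shows "(\<Sum>r<n. if d r = l then g r else 0) = 0"
proof -
  let ?h = "\<lambda>t. \<Sum>r<n. (t - l) * (g r / (t - d r))"
  have "((\<lambda>t. (t - l) * (g r / (t - d r))) \<longlongrightarrow> (if d r = l then g r else 0)) (at l)" for r
  proof (cases "d r = l")
    case True
    have "\<forall>\<^sub>F t in at l. g r = (t - l) * (g r / (t - d r))"
      using eventually_neq_at_within[of l] by eventually_elim (simp add: True)
    then show ?thesis using True by (simp add: tendsto_eventually eventually_mono)
  next
    case False
    then show ?thesis by (auto intro!: tendsto_eq_intros)
  qed
  then have "(?h \<longlongrightarrow> (\<Sum>r<n. if d r = l then g r else 0)) (at l)"
    by (intro tendsto_sum)
  moreover have "\<forall>\<^sub>F t in at l. \<forall>r\<in>{..<n}. t \<noteq> d r"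
    by (intro eventually_ball_finite ballI eventually_neq_at_within) auto
  then have "\<forall>\<^sub>F t in at l. ?h t = 0"
  proof eventually_elim
    case (elim t)
    then have "(\<Sum>r<n. g r / (t - d r)) = 0" by (intro zero) simp
    then show ?case unfolding sum_distrib_left[symmetric] by simp
  qed
  then have "(?h \<longlongrightarrow> 0) (at l)"
    by (rule tendsto_eventually)
  ultimately show ?thesis
    by (rule tendsto_unique[OF at_neq_bot])
qed

text \<open>Away from the poles the common factor \<open>prod (t - d r)\<close> can be divided out,
  leaving equal rational functions and hence equal residues. The residue at \<open>l\<close> is the
  inner product of the components of the two vectors in the \<open>l\<close>-eigenspace.\<close>

lemma char_poly_rank_one_eq_imp_residues_eq:
  assumes carr: "u \<in> carrier_vec n" "v \<in> carrier_vec n" "u' \<in> carrier_vec n" "v' \<in> carrier_vec n"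
    and eq: "char_poly (mat_diag n d + outer u v) = char_poly (mat_diag n d + outer u' v')"
  shows "(\<Sum>r<n. if d r = l then u $ r * v $ r else 0) = (\<Sum>r<n. if d r = l then u' $ r * v' $ r else 0)"
proof -
  have "(\<Sum>r<n. (u $ r * v $ r - u' $ r * v' $ r) / (t - d r)) = 0" if t: "\<And>r. r < n \<Longrightarrow> t \<noteq> d r" for t
  proof -
    have "(\<Prod>r<n. t - d r) \<noteq> 0" using t by auto
    then have "(\<Sum>r<n. u $ r * v $ r / (t - d r)) = (\<Sum>r<n. u' $ r * v' $ r / (t - d r))"
      using poly_char_poly_mat_diag_plus_outer[where d = d and t = t, OF carr(1,2) t]
        poly_char_poly_mat_diag_plus_outer[where d = d and t = t, OF carr(3,4) t] by (simp add: eq)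
    then show ?thesis by (simp add: diff_divide_distrib sum_subtractf)
  qed
  from partial_fractions_residue_zero[OF this, of l]
  have "(\<Sum>r<n. (if d r = l then u $ r * v $ r else 0) - (if d r = l then u' $ r * v' $ r else 0)) = 0"
    by (subst sum.cong[OF refl]) auto
  then show ?thesis by (simp add: sum_subtractf)
qed

section \<open>Orthogonal matrices commuting with a symmetric matrix\<close>

text \<open>Vectors with equal Gram matrices are moved onto each other one at a time by reflections;
  each reflection fixes the vectors already placed because it is taken along a difference that is
  orthogonal to them, and it commutes with \<open>B\<close> because that difference is an eigenvector.\<close>

lemma commuting_orthogonal_of_eigenvector_gram:
  assumes B: "symmetric_matrix n B" and "finite I"
    and "\<And>i. i \<in> I \<Longrightarrow> x i \<in> carrier_vec n \<and> B *\<^sub>v x i = c i \<cdot>\<^sub>v x i"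
    and "\<And>i. i \<in> I \<Longrightarrow> y i \<in> carrier_vec n \<and> B *\<^sub>v y i = c i \<cdot>\<^sub>v y i"
    and "\<And>i j. i \<in> I \<Longrightarrow> j \<in> I \<Longrightarrow> x i \<bullet> x j = y i \<bullet> y j"
  shows "\<exists>R. orthogonal_matrix n R \<and> B * R = R * B \<and> (\<forall>i\<in>I. R *\<^sub>v x i = y i)"
  using assms(2-)
proof (induction I rule: finite_induct)
  case empty
  have "B \<in> carrier_mat n n" using B by (simp add: symmetric_matrix_def)
  then show ?case by (intro exI[of _ "1\<^sub>m n"]) (simp add: orthogonal_matrix_one)
next
  case (insert k I)
  have Bc: "B \<in> carrier_mat n n" using B by (simp add: symmetric_matrix_def)
  obtain R where R: "orthogonal_matrix n R" and BR: "B * R = R * B"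
    and Rx: "\<And>i. i \<in> I \<Longrightarrow> R *\<^sub>v x i = y i"
    using insert.IH insert.prems by auto
  have Rc: "R \<in> carrier_mat n n" using orthogonal_matrixD[OF R] by simp
  \<comment> \<open>The isometry \<open>R\<close> found so far carries the new vector to
    \<open>z\<close>. As \<open>R\<close> commutes with \<open>B\<close>, \<open>z\<close> still has
    eigenvalue \<open>c k\<close>, and a reflection has only to move \<open>z\<close> to
    \<open>y k\<close>.\<close>
  define z where "z = R *\<^sub>v x k"
  have xk: "x k \<in> carrier_vec n" "B *\<^sub>v x k = c k \<cdot>\<^sub>v x k"
    and yk: "y k \<in> carrier_vec n" "B *\<^sub>v y k = c k \<cdot>\<^sub>v y k"
    using insert.prems(1,2)[of k] by auto
  have z: "z \<in> carrier_vec n" using Rc xk by (simp add: z_def)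
  have "B *\<^sub>v z = (R * B) *\<^sub>v x k"
    using Bc Rc xk by (simp add: z_def flip: BR)
  also have "\<dots> = c k \<cdot>\<^sub>v z"
    using Bc Rc xk by (simp add: z_def mult_mat_vec[of _ n n])
  finally have Bz: "B *\<^sub>v z = c k \<cdot>\<^sub>v z" .
  have Bzy: "B *\<^sub>v (z - y k) = c k \<cdot>\<^sub>v (z - y k)"
    using Bc z yk Bz by (intro eq_vecI) (simp_all add: mult_minus_distrib_mat_vec[of _ n n] right_diff_distrib)
  define H where "H = householder n (z - y k)"
  have H: "orthogonal_matrix n H" and BH: "B * H = H * B" and Hc: "H \<in> carrier_mat n n"
    using z yk by (simp_all add: H_def orthogonal_matrix_householder householder_commutes[OF B _ Bzy])
  have "z \<bullet> z = y k \<bullet> y k"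
    using orthogonal_matrix_scalar_prod[OF R xk(1) xk(1)] insert.prems(3)[of k k] by (simp add: z_def)
  then have Hz: "H *\<^sub>v z = y k"
    using z yk by (simp add: H_def householder_maps)
  have Hy: "H *\<^sub>v y i = y i" if i: "i \<in> I" for i
  proof -
    have carr: "x i \<in> carrier_vec n" "y i \<in> carrier_vec n" using insert.prems(1,2)[of i] i by auto
    have "z \<bullet> y i = y k \<bullet> y i"
      using orthogonal_matrix_scalar_prod[OF R xk(1) carr(1)] insert.prems(3)[of k i] i
      by (simp add: z_def Rx)
    then show ?thesis
      unfolding H_def using z yk carr
      by (intro householder_fixes) (simp_all add: minus_scalar_prod_distrib[of _ n])
  qed
  have "B * (H * R) = H * R * B"
    using assoc_mult_mat[OF Bc Hc Rc] assoc_mult_mat[OF Hc Bc Rc] assoc_mult_mat[OF Hc Rc Bc]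
    unfolding BH BR by argo
  moreover have "(H * R) *\<^sub>v x i = y i" if "i \<in> insert k I" for i
    using that insert.prems(1)[of i] Hz Hy Rx assoc_mult_mat_vec[OF Hc Rc, of "x i"]
    by (cases "i = k") (simp_all add: z_def)
  ultimately show ?case
    using orthogonal_matrix_mult[OF H R] by blast
qed

section \<open>The orthogonal conjugation\<close>

lemma orthogonal_conjugation_inverse:
  assumes M: "M \<in> carrier_mat n n" and Q: "orthogonal_matrix n Q"
  shows "Q * (transpose_mat Q * M * Q) * transpose_mat Q = M"
proof -
  note Q = orthogonal_matrixD[OF Q]
  have Qt: "transpose_mat Q \<in> carrier_mat n n" using Q(1) by simp
  have "Q * (transpose_mat Q * M * Q) * transpose_mat Q = (Q * transpose_mat Q) * M * (Q * transpose_mat Q)"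
    using Q(1) Qt M by (simp add: assoc_mult_mat[of _ n n _ n _ n])
  then show ?thesis using M by (simp add: Q(3))
qed

text \<open>Comparing the \<open>(r, q)\<close> entries gives
  \<open>d r * R_rq = R_rq * d q\<close>. Thus \<open>R\<close> is block diagonal along the
  eigenspaces.\<close>

lemma commutes_with_mat_diag_entry:
  fixes d :: "nat \<Rightarrow> real"
  assumes R: "R \<in> carrier_mat n n" and comm: "mat_diag n d * R = R * mat_diag n d"
    and "r < n" "q < n" "d r \<noteq> d q"
  shows "R $$ (r, q) = 0"
proof -
  have "d r * R $$ (r, q) = R $$ (r, q) * d q"
    using arg_cong[OF comm, of "\<lambda>X. X $$ (r, q)"] assms(3,4)
    by (simp add: mat_diag_mult_left[OF R] mat_diag_mult_right[OF R])
  then show ?thesis using assms(5) by simp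
qed

text \<open>The orthogonal projection onto the \<open>l\<close>-eigenspace of
  \<open>mat_diag n d\<close>.\<close>

definition eigen_part :: "nat \<Rightarrow> (nat \<Rightarrow> real) \<Rightarrow> real \<Rightarrow> real vec \<Rightarrow> real vec" where
  "eigen_part n d l z = vec n (\<lambda>r. if d r = l then z $ r else 0)"

lemma eigen_part_carrier [simp]: "eigen_part n d l z \<in> carrier_vec n"
  by (simp add: eigen_part_def)

lemma mat_diag_mult_vec:
  fixes d :: "nat \<Rightarrow> 'a :: comm_semiring_1"
  assumes z: "z \<in> carrier_vec n"
  shows "mat_diag n d *\<^sub>v z = vec n (\<lambda>r. d r * z $ r)"
proof (rule eq_vecI)
  fix r assume "r < dim_vec (vec n (\<lambda>r. d r * z $ r))"
  then have r: "r < n" by simp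
  have "(mat_diag n d *\<^sub>v z) $ r = (\<Sum>q = 0..<n. mat_diag n d $$ (r, q) * z $ q)"
    using r z carrier_matD[OF mat_diag_dim, of n d] by (simp add: scalar_prod_def)
  also have "\<dots> = (\<Sum>q = 0..<n. if r = q then d q * z $ q else 0)"
    using r by (intro sum.cong) (auto simp: mat_diag_def)
  finally show "(mat_diag n d *\<^sub>v z) $ r = vec n (\<lambda>r. d r * z $ r) $ r"
    using r by simp
qed (simp add: mat_diag_def)

lemma mat_diag_mult_eigen_part: "mat_diag n d *\<^sub>v eigen_part n d l z = l \<cdot>\<^sub>v eigen_part n d l z"
  by (subst mat_diag_mult_vec[OF eigen_part_carrier]) (auto simp: eigen_part_def)

text \<open>Components for different eigenvalues have disjoint supports. For a common eigenvalue the
  product is exactly the residue sum, which turns equal residues into equal Gram matrices.\<close>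

lemma eigen_part_scalar_prod:
  "eigen_part n d l z \<bullet> eigen_part n d m w
    = (if l = m then \<Sum>r<n. if d r = l then z $ r * w $ r else 0 else 0)"
  by (auto simp: eigen_part_def scalar_prod_def lessThan_atLeast0 intro!: sum.cong sum.neutral)

lemma orthogonal_conjugation_fixing_exists:
  assumes A: "symmetric_matrix n A" and B: "symmetric_matrix n B"
    and e: "\<And>i. i < p \<Longrightarrow> e i \<in> carrier_vec n"
    and eq: "char_poly A = char_poly B"
    and eq_outer: "\<And>i j. i < p \<Longrightarrow> j < p \<Longrightarrow>
      char_poly (A + outer (e i) (e j)) = char_poly (B + outer (e i) (e j))"
  shows "\<exists>Q. conjugates_fixing n p e A B Q"
proof -
  have Ac: "A \<in> carrier_mat n n" and Bc: "B \<in> carrier_mat n n"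
    using A B by (simp_all add: symmetric_matrix_def)
  obtain es where es: "char_poly A = (\<Prod>a\<leftarrow>es. [:- a, 1:])"
    using symmetric_char_poly_factorized[OF A] .
  define d where "d = (!) es"
  define D where "D = mat_diag n d"
  obtain U where U: "orthogonal_matrix n U" and UD: "transpose_mat U * A * U = D"
    using orthogonal_diagonalization[OF A es] by (auto simp: D_def d_def)
  obtain V where V: "orthogonal_matrix n V" and VD: "transpose_mat V * B * V = D"
    using orthogonal_diagonalization[OF B] es eq by (auto simp: D_def d_def)
  note Uc = orthogonal_matrixD(1)[OF U] and Vc = orthogonal_matrixD(1)[OF V]
  have Utc: "transpose_mat U \<in> carrier_mat n n" and Vtc: "transpose_mat V \<in> carrier_mat n n"
    using Uc Vc by simp_all
  have Dc: "D \<in> carrier_mat n n" and D: "symmetric_matrix n D"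
    by (auto simp: D_def symmetric_matrix_def mat_diag_def intro!: eq_matI)
  define x where "x i = transpose_mat U *\<^sub>v e i" for i
  define y where "y i = transpose_mat V *\<^sub>v e i" for i
  have x: "x i \<in> carrier_vec n" and y: "y i \<in> carrier_vec n" if "i < p" for i
    using e[OF that] Utc Vtc by (simp_all add: x_def y_def)
  \<comment> \<open>Conjugation turns the perturbation of \<open>A\<close> or \<open>B\<close> into
    a rank-one perturbation of \<open>D\<close>.\<close>
  have conj_outer: "transpose_mat P * (M + outer (e i) (e j)) * P
      = transpose_mat P * M * P + outer (transpose_mat P *\<^sub>v e i) (transpose_mat P *\<^sub>v e j)"
    if "P \<in> carrier_mat n n" "M \<in> carrier_mat n n" "i < p" "j < p" for P M i j
    using that e[of i] e[of j]
    by (simp add: mult_add_distrib_mat[of _ n n _ n] add_mult_distrib_mat[of _ n n _ _ n]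
        mult_outer_mult[of _ n])
  have residues: "(\<Sum>r<n. if d r = l then x i $ r * x j $ r else 0)
      = (\<Sum>r<n. if d r = l then y i $ r * y j $ r else 0)" if "i < p" "j < p" for i j l
  proof -
    have outer: "outer (e i) (e j) \<in> carrier_mat n n" using e that by simp
    have "char_poly (D + outer (x i) (x j)) = char_poly (A + outer (e i) (e j))"
      using orthogonal_conjugation_char_poly[OF _ U, of "A + outer (e i) (e j)"] Ac outer
      by (simp add: conj_outer[OF Uc Ac that] UD x_def)
    moreover have "char_poly (D + outer (y i) (y j)) = char_poly (B + outer (e i) (e j))"
      using orthogonal_conjugation_char_poly[OF _ V, of "B + outer (e i) (e j)"] Bc outer
      by (simp add: conj_outer[OF Vc Bc that] VD y_def)
    ultimately show ?thesis
      using that x y eq_outer[OF that] unfolding D_def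
      by (intro char_poly_rank_one_eq_imp_residues_eq) simp_all
  qed
  \<comment> \<open>The vectors are indexed by pairs of an eigenvalue and a position
    \<open>i\<close>, so \<open>fst\<close> reads off the eigenvalue. One \<open>R\<close> serves
    all eigenspaces at once.\<close>
  have "\<exists>R. orthogonal_matrix n R \<and> D * R = R * D \<and> (\<forall>k\<in>d ` {..<n} \<times> {..<p}.
      R *\<^sub>v (case k of (l, i) \<Rightarrow> eigen_part n d l (x i)) = (case k of (l, i) \<Rightarrow> eigen_part n d l (y i)))"
    using residues
    by (intro commuting_orthogonal_of_eigenvector_gram[OF D, where c = fst])
      (auto simp: D_def mat_diag_mult_eigen_part eigen_part_scalar_prod split: prod.splits)
  then obtain R where R: "orthogonal_matrix n R" and DR: "D * R = R * D"
    and R_parts: "\<forall>k\<in>d ` {..<n} \<times> {..<p}.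
      R *\<^sub>v (case k of (l, i) \<Rightarrow> eigen_part n d l (x i)) = (case k of (l, i) \<Rightarrow> eigen_part n d l (y i))"
    by blast
  have R_part: "R *\<^sub>v eigen_part n d (d r) (x i) = eigen_part n d (d r) (y i)" if "r < n" "i < p" for r i
    using bspec[OF R_parts, of "(d r, i)"] that by simp
  note RD = orthogonal_matrixD[OF R]
  have Rtc: "transpose_mat R \<in> carrier_mat n n" using RD by simp
  have Rx: "R *\<^sub>v x i = y i" if i: "i < p" for i
  proof (rule eq_vecI)
    fix r assume "r < dim_vec (y i)"
    then have r: "r < n" using y[OF i] by simp
    \<comment> \<open>Row \<open>r\<close> of \<open>R\<close> vanishes outside the eigenspace of
      \<open>d r\<close>, so only that component of \<open>x i\<close> contributes.\<close>
    have "(R *\<^sub>v x i) $ r = (R *\<^sub>v eigen_part n d (d r) (x i)) $ r"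
      using r RD(1) x[OF i] commutes_with_mat_diag_entry[OF RD(1) DR[unfolded D_def] r]
      by (auto simp: scalar_prod_def eigen_part_def intro!: sum.cong)
    then show "(R *\<^sub>v x i) $ r = y i $ r"
      using r R_part[OF r i] by (simp add: eigen_part_def)
  qed (use RD x[OF i] y[OF i] in auto)
  \<comment> \<open>Its transpose \<open>V R U^T\<close> takes \<open>e i\<close> to
    \<open>x i\<close>, then to \<open>y i\<close>, and back to \<open>e i\<close>; the conjugation
    takes \<open>A\<close> to \<open>D\<close>, keeps \<open>D\<close>, and ends at
    \<open>B\<close>.\<close>
  define Q where "Q = U * transpose_mat R * transpose_mat V"
  have Q: "orthogonal_matrix n Q"
    unfolding Q_def by (intro orthogonal_matrix_mult orthogonal_matrix_transpose U V R)
  have Qt: "transpose_mat Q = V * (R * transpose_mat U)"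
    using Uc Vc RD(1) Utc Vtc Rtc by (simp add: Q_def transpose_mult[of _ n n _ n])
  have "transpose_mat Q * A * Q = V * (R * (transpose_mat U * A * U) * transpose_mat R) * transpose_mat V"
    unfolding Qt unfolding Q_def
    using Uc Vc RD(1) Utc Vtc Rtc Ac by (simp add: assoc_mult_mat[of _ n n _ n _ n])
  also have "R * (transpose_mat U * A * U) * transpose_mat R = D * (R * transpose_mat R)"
    using RD(1) Rtc Dc by (simp add: UD assoc_mult_mat[of _ n n _ n _ n] flip: DR)
  also have "\<dots> = D"
    using Dc by (simp add: RD(3))
  also have "V * D * transpose_mat V = B"
    using orthogonal_conjugation_inverse[OF Bc V] by (simp add: VD)
  finally have "transpose_mat Q * A * Q = B" .
  moreover have "transpose_mat Q *\<^sub>v e i = e i" if i: "i < p" for i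
  proof -
    have "transpose_mat Q *\<^sub>v e i = V *\<^sub>v (R *\<^sub>v x i)"
      using Vc RD(1) Utc e[OF i] by (simp add: Qt x_def assoc_mult_mat_vec[of _ n n _ n])
    also have "\<dots> = e i"
      using orthogonal_matrix_mult_vec(2)[OF V e[OF i]] by (simp add: Rx[OF i] y_def)
    finally show ?thesis .
  qed
  ultimately show ?thesis using Q unfolding conjugates_fixing_def by blast
qed

section \<open>Powers applied to the fixed vectors, and the matrix \<open>W_tilde\<close>\<close>

lemma conjugates_fixing_intertwines:
  assumes A: "A \<in> carrier_mat n n" and Q: "conjugates_fixing n p e A B Q"
  shows "B * transpose_mat Q = transpose_mat Q * A"
proof -
  have orth: "orthogonal_matrix n Q" and B: "transpose_mat Q * A * Q = B"
    using Q by (simp_all add: conjugates_fixing_def)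
  note Q = orthogonal_matrixD[OF orth]
  have Qt: "transpose_mat Q \<in> carrier_mat n n" using Q(1) by simp
  have "B * transpose_mat Q = transpose_mat Q * A * (Q * transpose_mat Q)"
    unfolding B[symmetric] by (rule assoc_mult_mat[OF _ Q(1) Qt]) (use Qt A in auto)
  then show ?thesis using Qt A by (simp add: Q(3))
qed

lemma intertwined_powers_mult_vec:
  fixes A B P :: "'a :: comm_ring_1 mat"
  assumes carr: "A \<in> carrier_mat n n" "B \<in> carrier_mat n n" "P \<in> carrier_mat n n"
    and BP: "B * P = P * A" and x: "x \<in> carrier_vec n"
  shows "(B ^\<^sub>m j) *\<^sub>v (P *\<^sub>v x) = P *\<^sub>v ((A ^\<^sub>m j) *\<^sub>v x)"
  using x
\<comment> \<open>The vector must vary: the step peels the rightmost factor off the power and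
  applies it to \<open>x\<close> first.\<close>
proof (induction j arbitrary: x)
  case 0
  then show ?case using carr by simp
next
  case (Suc j)
  have pow: "A ^\<^sub>m j \<in> carrier_mat n n" "B ^\<^sub>m j \<in> carrier_mat n n"
    using carr by (simp_all add: pow_carrier_mat)
  have Ax: "A *\<^sub>v x \<in> carrier_vec n" and Px: "P *\<^sub>v x \<in> carrier_vec n" using carr Suc.prems by simp_all
  have "(B ^\<^sub>m Suc j) *\<^sub>v (P *\<^sub>v x) = (B ^\<^sub>m j) *\<^sub>v (B *\<^sub>v (P *\<^sub>v x))"
    using assoc_mult_mat_vec[OF pow(2) carr(2) Px] by simp
  also have "B *\<^sub>v (P *\<^sub>v x) = P *\<^sub>v (A *\<^sub>v x)"
    using assoc_mult_mat_vec[OF carr(2,3) Suc.prems] assoc_mult_mat_vec[OF carr(3,1) Suc.prems] by (simp add: BP)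
  also have "(B ^\<^sub>m j) *\<^sub>v (P *\<^sub>v (A *\<^sub>v x)) = P *\<^sub>v ((A ^\<^sub>m j) *\<^sub>v (A *\<^sub>v x))"
    by (rule Suc.IH[OF Ax])
  also have "(A ^\<^sub>m j) *\<^sub>v (A *\<^sub>v x) = (A ^\<^sub>m Suc j) *\<^sub>v x"
    using assoc_mult_mat_vec[OF pow(1) carr(1) Suc.prems] by simp
  finally show ?case .
qed

lemma mult_mat_of_cols:
  assumes "P \<in> carrier_mat n n" "set vs \<subseteq> carrier_vec n"
  shows "P * mat_of_cols n vs = mat_of_cols n (map (\<lambda>v. P *\<^sub>v v) vs)"
proof (rule eq_matI)
  fix i j assume "i < dim_row (mat_of_cols n (map (\<lambda>v. P *\<^sub>v v) vs))"
    and "j < dim_col (mat_of_cols n (map (\<lambda>v. P *\<^sub>v v) vs))"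
  then have ij: "i < n" "j < length vs" by simp_all
  have "vs ! j \<in> carrier_vec n" using assms(2) ij by auto
  then show "(P * mat_of_cols n vs) $$ (i, j) = mat_of_cols n (map (\<lambda>v. P *\<^sub>v v) vs) $$ (i, j)"
    using ij assms(1) by (simp add: mat_of_cols_index)
qed (use assms in auto)

text \<open>Column by column, \<open>Q^T A^j e_i = B^j Q^T e_i = B^j e_i\<close>.\<close>

lemma conjugates_fixing_W_tilde:
  assumes A: "A \<in> carrier_mat n n" and Q: "conjugates_fixing n p e A B Q"
    and e: "\<And>i. i < p \<Longrightarrow> e i \<in> carrier_vec n"
  shows "transpose_mat Q * W_tilde n p e A = W_tilde n p e B"
proof -
  have orth: "orthogonal_matrix n Q" and QAQ: "transpose_mat Q * A * Q = B"
    and fix_e: "\<And>i. i < p \<Longrightarrow> transpose_mat Q *\<^sub>v e i = e i"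
    using Q by (simp_all add: conjugates_fixing_def)
  have Qc: "Q \<in> carrier_mat n n" and Qt: "transpose_mat Q \<in> carrier_mat n n"
    using orthogonal_matrixD(1)[OF orth] by simp_all
  have B: "B \<in> carrier_mat n n"
    using Qc Qt A by (auto simp flip: QAQ)
  have krylov: "transpose_mat Q *\<^sub>v ((A ^\<^sub>m j) *\<^sub>v e i) = (B ^\<^sub>m j) *\<^sub>v e i" if "i < p" for i j
    using intertwined_powers_mult_vec[OF A B Qt conjugates_fixing_intertwines[OF A Q] e[OF that], of j]
    by (simp add: fix_e[OF that])
  have "transpose_mat Q * W_tilde n p e A
      = mat_of_cols n (map ((*\<^sub>v) (transpose_mat Q)) [(A ^\<^sub>m j) *\<^sub>v e i. i \<leftarrow> [0..<p], j \<leftarrow> [0..<n]])"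
    unfolding W_tilde_def using e A
    by (intro mult_mat_of_cols[OF Qt]) (auto intro!: mult_mat_vec_carrier[of _ n n] pow_carrier_mat)
  also have "map ((*\<^sub>v) (transpose_mat Q)) [(A ^\<^sub>m j) *\<^sub>v e i. i \<leftarrow> [0..<p], j \<leftarrow> [0..<n]]
      = [(B ^\<^sub>m j) *\<^sub>v e i. i \<leftarrow> [0..<p], j \<leftarrow> [0..<n]]"
    unfolding map_concat by (intro arg_cong[where f = concat]) (auto simp: krylov)
  finally show ?thesis by (simp add: W_tilde_def)
qed

section \<open>The matrix families\<close>

lemma length_tuple_of: "length (tuple_of p e A) = 1 + p\<^sup>2"
  by (simp add: tuple_of_def length_concat sum_list_triv o_def power2_eq_square)

lemma tuple_of_nth_0: "tuple_of p e A ! 0 = A"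
  by (simp add: tuple_of_def)

lemma tuple_of_nth_Suc:
  "tuple_of p e A ! Suc k = [outer (e i) (e j). i \<leftarrow> [0..<p], j \<leftarrow> [0..<p]] ! k"
  by (simp add: tuple_of_def)

text \<open>Membership in the list of outer products yields the pair \<open>(i, j)\<close> without
  decoding the position. The pair is chosen before the head \<open>A\<close>, so it is shared by
  both tuples.\<close>

lemma tuple_of_nth_Suc_cases:
  assumes "k < p\<^sup>2"
  obtains i j where "i < p" "j < p" "\<And>A. tuple_of p e A ! Suc k = outer (e i) (e j)"
proof -
  define L where "L = [outer (e i) (e j). i \<leftarrow> [0..<p], j \<leftarrow> [0..<p]]"
  have "k < length L"
    using assms by (simp add: L_def length_concat sum_list_triv o_def power2_eq_square)
  then have "L ! k \<in> set L" by (rule nth_mem)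
  then obtain i j where "i < p" "j < p" "L ! k = outer (e i) (e j)"
    by (auto simp: L_def)
  then show ?thesis by (intro that) (simp_all only: tuple_of_nth_Suc flip: L_def)
qed

lemma tuple_of_outer_index:
  assumes "i < p" "j < p"
  obtains k where "k < p\<^sup>2" "\<And>A. tuple_of p e A ! Suc k = outer (e i) (e j)"
proof -
  define L where "L = [outer (e i) (e j). i \<leftarrow> [0..<p], j \<leftarrow> [0..<p]]"
  have "outer (e i) (e j) \<in> set L"
    using assms by (auto simp: L_def intro!: bexI[of _ i] image_eqI[of _ _ j])
  then obtain k where k: "k < length L" "L ! k = outer (e i) (e j)"
    by (auto simp: in_set_conv_nth)
  have "length L = p\<^sup>2"
    by (simp add: L_def length_concat sum_list_triv o_def power2_eq_square)
  with k show ?thesis by (intro that[of k]) (simp_all only: tuple_of_nth_Suc flip: L_def)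
qed

lemma W_carrier [simp]: "W n As s \<in> carrier_mat n n"
  by (simp add: W_def)

text \<open>Where \<open>W\<close> is the complexification of a real matrix, injectivity of the
  embedding brings the equality back to real polynomials.\<close>

lemma phi_eq_real:
  assumes "M \<in> carrier_mat n n" "W n As s = map_mat complex_of_real M"
    and "M' \<in> carrier_mat n n" "W n Bs s = map_mat complex_of_real M'"
    and "phi n As s = phi n Bs s"
  shows "char_poly M = char_poly M'"
proof -
  have "map_poly complex_of_real (char_poly M) = map_poly complex_of_real (char_poly M')"
    using assms by (simp add: phi_def of_real_hom.char_poly_hom)
  then show ?thesis by (rule of_real_poly_hom.injectivity)
qed

text \<open>Zero-one points \<open>s\<close> select subsums of the tuple; \<open>{0}\<close> and
  \<open>{0, Suc k}\<close> give \<open>A\<close> and \<open>A + e_i e_j^T\<close>.\<close>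

lemma W_indicator:
  assumes "K \<subseteq> {..<length As}"
  shows "W n As (vec (length As) (\<lambda>i. if i \<in> K then 1 else 0))
    = mat n n (\<lambda>rc. \<Sum>i\<in>K. complex_of_real ((As ! i) $$ rc))"
proof -
  have "(\<Sum>i<length As. vec (length As) (\<lambda>i. if i \<in> K then 1 else 0) $ i * complex_of_real ((As ! i) $$ rc))
      = (\<Sum>i\<in>K. complex_of_real ((As ! i) $$ rc))" for rc
    using assms by (intro sum.mono_neutral_cong_right) auto
  then show ?thesis by (simp only: W_def)
qed

lemma W_tuple_of_first:
  assumes "A \<in> carrier_mat n n"
  shows "W n (tuple_of p e A) (vec (1 + p\<^sup>2) (\<lambda>i. if i \<in> {0} then 1 else 0)) = map_mat complex_of_real A"
proof -
  have "{0} \<subseteq> {..<length (tuple_of p e A)}" unfolding length_tuple_of by simp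
  from W_indicator[OF this, of n] show ?thesis
    unfolding length_tuple_of using assms by (auto simp: tuple_of_nth_0 intro!: eq_matI)
qed

lemma W_tuple_of_first_plus:
  assumes A: "A \<in> carrier_mat n n" and k: "k < p\<^sup>2"
    and J: "J \<in> carrier_mat n n" "tuple_of p e A ! Suc k = J"
  shows "W n (tuple_of p e A) (vec (1 + p\<^sup>2) (\<lambda>i. if i \<in> {0, Suc k} then 1 else 0))
    = map_mat complex_of_real (A + J)"
proof -
  have "{0, Suc k} \<subseteq> {..<length (tuple_of p e A)}" unfolding length_tuple_of using k by simp
  from W_indicator[OF this, of n] show ?thesis
    unfolding length_tuple_of using A J by (auto simp: tuple_of_nth_0 intro!: eq_matI)
qed

lemma index_mult_mult_mat:
  fixes P M R :: "'a :: semiring_0 mat"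
  assumes "P \<in> carrier_mat n n" "M \<in> carrier_mat n n" "R \<in> carrier_mat n n" "r < n" "c < n"
  shows "(P * M * R) $$ (r, c) = (\<Sum>b<n. \<Sum>a<n. P $$ (r, a) * M $$ (a, b) * R $$ (b, c))"
  using assms by (simp add: scalar_prod_def sum_distrib_right lessThan_atLeast0
      del: assoc_mult_mat)

text \<open>Conjugation is linear, so exchanging the sum over the tuple with the two sums of the
  matrix product reduces the claim to single members.\<close>

lemma W_conjugate:
  assumes Q: "Q \<in> carrier_mat n n" and P: "P \<in> carrier_mat n n" and len: "length As = length Bs"
    and As: "\<And>i. i < length As \<Longrightarrow> As ! i \<in> carrier_mat n n \<and> P * (As ! i) * Q = Bs ! i"
  shows "map_mat complex_of_real P * W n As s * map_mat complex_of_real Q = W n Bs s"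
proof (rule eq_matI)
  fix r c assume "r < dim_row (W n Bs s)" "c < dim_col (W n Bs s)"
  then have rc: "r < n" "c < n" by (simp_all add: W_def)
  have "(map_mat complex_of_real P * W n As s * map_mat complex_of_real Q) $$ (r, c)
      = (\<Sum>b<n. \<Sum>a<n. \<Sum>i<length As.
          s $ i * complex_of_real (P $$ (r, a) * (As ! i) $$ (a, b) * Q $$ (b, c)))"
    using rc P Q
    by (subst index_mult_mult_mat[of _ n])
      (auto simp: W_def sum_distrib_left sum_distrib_right mult_ac intro!: sum.cong)
  also have "\<dots> = (\<Sum>i<length As. s $ i * complex_of_real (\<Sum>b<n. \<Sum>a<n. P $$ (r, a) * (As ! i) $$ (a, b) * Q $$ (b, c)))"
    by (simp only: sum.swap[of _ _ "{..<length As}"] of_real_sum sum_distrib_left)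
  also have "\<dots> = (\<Sum>i<length As. s $ i * complex_of_real ((Bs ! i) $$ (r, c)))"
  proof (rule sum.cong[OF refl])
    fix i assume "i \<in> {..<length As}"
    then have "As ! i \<in> carrier_mat n n" "P * (As ! i) * Q = Bs ! i" using As by auto
    then show "s $ i * complex_of_real (\<Sum>b<n. \<Sum>a<n. P $$ (r, a) * (As ! i) $$ (a, b) * Q $$ (b, c))
        = s $ i * complex_of_real ((Bs ! i) $$ (r, c))"
      using index_mult_mult_mat[OF P _ Q rc, of "As ! i"] by simp
  qed
  finally show "(map_mat complex_of_real P * W n As s * map_mat complex_of_real Q) $$ (r, c) = W n Bs s $$ (r, c)"
    using rc len by (simp add: W_def)
qed (use P Q in \<open>auto simp: W_def\<close>)

text \<open>The head is conjugated to \<open>B\<close> by assumption, and each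
  \<open>e_i e_j^T\<close> is preserved because \<open>Q^T\<close> fixes both vectors.\<close>

lemma conjugates_fixing_W:
  assumes A: "A \<in> carrier_mat n n" and Q: "conjugates_fixing n p e A B Q"
    and e: "\<And>i. i < p \<Longrightarrow> e i \<in> carrier_vec n"
  shows "map_mat complex_of_real (transpose_mat Q) * W n (tuple_of p e A) s * map_mat complex_of_real Q
    = W n (tuple_of p e B) s"
proof (rule W_conjugate)
  have orth: "orthogonal_matrix n Q" and QAQ: "transpose_mat Q * A * Q = B"
    and fix_e: "\<And>i. i < p \<Longrightarrow> transpose_mat Q *\<^sub>v e i = e i"
    using Q by (simp_all add: conjugates_fixing_def)
  show Qc: "Q \<in> carrier_mat n n" and Qt: "transpose_mat Q \<in> carrier_mat n n"
    using orthogonal_matrixD(1)[OF orth] by simp_all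
  fix k assume "k < length (tuple_of p e A)"
  then have k: "k < 1 + p\<^sup>2" by (simp only: length_tuple_of)
  show "tuple_of p e A ! k \<in> carrier_mat n n \<and> transpose_mat Q * (tuple_of p e A ! k) * Q = tuple_of p e B ! k"
  proof (cases k)
    case 0
    then show ?thesis using A QAQ by (simp add: tuple_of_nth_0)
  next
    case (Suc l)
    then obtain i j where "i < p" "j < p" "\<And>A. tuple_of p e A ! Suc l = outer (e i) (e j)"
      using k tuple_of_nth_Suc_cases[of l p e] by auto
    then show ?thesis
      using e fix_e Qt Qc by (simp add: Suc mult_outer_mult[of _ n])
  qed
qed (simp add: length_tuple_of)

text \<open>The complexifications of \<open>Q^T\<close> and \<open>Q\<close> are still mutually
  inverse, so the two values of \<open>W\<close> are similar.\<close>

lemma conjugates_fixing_phi: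
  assumes A: "A \<in> carrier_mat n n" and Q: "conjugates_fixing n p e A B Q"
    and e: "\<And>i. i < p \<Longrightarrow> e i \<in> carrier_vec n"
  shows "phi n (tuple_of p e A) s = phi n (tuple_of p e B) s"
proof -
  have orth: "orthogonal_matrix n Q" using Q by (simp add: conjugates_fixing_def)
  note QD = orthogonal_matrixD[OF orth]
  let ?P = "map_mat complex_of_real (transpose_mat Q)" and ?Q = "map_mat complex_of_real Q"
  have Qt: "transpose_mat Q \<in> carrier_mat n n" using QD(1) by simp
  have "?P * ?Q = 1\<^sub>m n" "?Q * ?P = 1\<^sub>m n"
    using of_real_hom.mat_hom_mult[OF Qt QD(1), symmetric] of_real_hom.mat_hom_mult[OF QD(1) Qt, symmetric]
    unfolding QD(2,3) of_real_hom.mat_hom_one .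
  then have "similar_mat (W n (tuple_of p e B) s) (W n (tuple_of p e A) s)"
    using conjugates_fixing_W[OF A Q e, of s] QD(1) Qt
    by (intro similar_matI[where P = ?P and Q = ?Q and n = n]) auto
  then show ?thesis by (simp add: phi_def char_poly_similar)
qed

theorem theorem2p1:
  fixes n p :: nat and A1 B1 :: "real mat" and e :: "nat \<Rightarrow> real vec"
  assumes "symmetric_matrix n A1" and "symmetric_matrix n B1"
    and "\<And>i. i < p \<Longrightarrow> zero_one_vec n (e i)"
    and "disjoint_family_on (\<lambda>i. vec_support (e i)) {..<p}"
  shows "((\<forall>s \<in> carrier_vec (1 + p\<^sup>2). phi n (tuple_of p e A1) s = phi n (tuple_of p e B1) s)
            \<longleftrightarrow> (\<exists>Q. conjugates_fixing n p e A1 B1 Q))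
       \<and> (\<forall>Q. conjugates_fixing n p e A1 B1 Q \<longrightarrow>
            (\<forall>s \<in> carrier_vec (1 + p\<^sup>2).
               map_mat complex_of_real (transpose_mat Q) * W n (tuple_of p e A1) s
                 * map_mat complex_of_real Q = W n (tuple_of p e B1) s)
          \<and> transpose_mat Q * W_tilde n p e A1 = W_tilde n p e B1)"
proof -
  have A: "A1 \<in> carrier_mat n n" and B: "B1 \<in> carrier_mat n n"
    using assms(1,2) by (simp_all add: symmetric_matrix_def)
  have e: "e i \<in> carrier_vec n" if "i < p" for i
    using assms(3)[OF that] by (simp add: zero_one_vec_def)
  \<comment> \<open>For existence the hypothesis is evaluated only at the points selecting
    \<open>A1\<close>, \<open>B1\<close> and their sums with one \<open>e_i e_j^T\<close>.\<close>
  have "\<exists>Q. conjugates_fixing n p e A1 B1 Q"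
    if phi: "\<And>s. s \<in> carrier_vec (1 + p\<^sup>2) \<Longrightarrow> phi n (tuple_of p e A1) s = phi n (tuple_of p e B1) s"
  proof (rule orthogonal_conjugation_fixing_exists[OF assms(1,2) e])
    show "char_poly A1 = char_poly B1"
      by (rule phi_eq_real[OF A W_tuple_of_first[OF A] B W_tuple_of_first[OF B] phi]) simp
    fix i j assume ij: "i < p" "j < p"
    then obtain k where k: "k < p\<^sup>2" "\<And>A. tuple_of p e A ! Suc k = outer (e i) (e j)"
      using tuple_of_outer_index by blast
    have J: "outer (e i) (e j) \<in> carrier_mat n n" using e ij by simp
    show "char_poly (A1 + outer (e i) (e j)) = char_poly (B1 + outer (e i) (e j))"
      by (rule phi_eq_real[OF _ W_tuple_of_first_plus[OF A k(1) J k(2)] _ W_tuple_of_first_plus[OF B k(1) J k(2)] phi])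
        (use A B J in simp_all)
  qed
  moreover have "phi n (tuple_of p e A1) s = phi n (tuple_of p e B1) s"
    and "map_mat complex_of_real (transpose_mat Q) * W n (tuple_of p e A1) s * map_mat complex_of_real Q
      = W n (tuple_of p e B1) s"
    and "transpose_mat Q * W_tilde n p e A1 = W_tilde n p e B1"
    if "conjugates_fixing n p e A1 B1 Q" for Q s
    by (rule conjugates_fixing_phi[OF A that e] conjugates_fixing_W[OF A that e]
        conjugates_fixing_W_tilde[OF A that e]; assumption)+
  ultimately show ?thesis by blast
qed

end
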